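(* Let prompts be distributed as $s\sim P(s)$, let $\pi_\phi(a\mid s)$ be a policy, let $R^*(s,a)$ be a true reward function that is $L$-Lipschitz in the action, i.e. $|R^*(s,a_1)-R^*(s,a_2)|\le L\|a_1-a_2\|$ for all $s,a_1,a_2$, and let $\widetilde{R}(s,a)$ be a proxy reward. Let $\delta>0$ and $K>L\delta$. Then the excess Bradley–Terry loss of $\widetilde{R}$ satisfies $$\mathcal{L}_{\mathrm{BT}}(\widetilde{R})-\mathcal{L}_{\mathrm{BT}}(R^* )\ \ge\ 2\,\bigl(\sigma(K)-\sigma(L\delta)\bigr)^2\,P(S_{K,\delta}\mid\pi_\phi).$$
   Context: Actions lie in a normed space with norm $\|\cdot\|$; rewards are real-valued measurable functions of (state, action). $\sigma(x)=1/(1+e^{-x})$ is the logistic function. Bradley–Terry loss: draw $s\sim P(s)$, then $a_1,a_2$ i.i.d. from $\pi_\phi(\cdot\mid s)$, then a preference label $Y\in\{0,1\}$ with $P(Y=1\mid s,a_1,a_2)=\sigma(R^*(s,a_1)-R^*(s,a_2))$, where $Y=1$ means $a_1$ is preferred. The preferred action is called $a_{\mathrm{w}}$ and the other $a_{\mathrm{l}}$. For a reward function $R$, $\mathcal{L}_{\mathrm{BT}}(R):=-\mathbb{E}[\log\sigma(R(s,a_{\mathrm{w}})-R(s,a_{\mathrm{l}}))]$, the expectation being over this sampling process (labels are always generated from $R^*$). Sharpness set: $S_{K,\delta}:=\{(s,a_1,a_2):\|a_1-a_2\|\le\delta,\ |\widetilde{R}(s,a_1)-\widetilde{R}(s,a_2)|>K\}$,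 and $P(S_{K,\delta}\mid\pi_\phi)$ is its probability under $s\sim P(s)$ and $a_1,a_2$ i.i.d. from $\pi_\phi(\cdot\mid s)$. *)

theory Defs
  imports "HOL-Probability.Probability"
begin

definition logistic :: "real \<Rightarrow> real" where
  "logistic x = 1 / (1 + exp (- x))"

text \<open>
  \<open>P\<close> is the prompt distribution, \<open>A\<close> carries the action set and its \<open>\<sigma>\<close>-algebra, and the
  policy \<open>\<pi>\<close> is a Markov kernel from \<open>P\<close> to \<open>A\<close>. Only the measurable space underlying \<open>A\<close>
  matters, not the values of the measure \<open>A\<close>.
\<close>

definition action_pairs ::
    "'s measure \<Rightarrow> 'a measure \<Rightarrow> ('s \<Rightarrow> 'a measure) \<Rightarrow> ('s \<times> 'a \<times> 'a) measure" where
  "action_pairs P A \<pi> = do {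
     s \<leftarrow> P;
     a1 \<leftarrow> \<pi> s;
     a2 \<leftarrow> \<pi> s;
     return (P \<Otimes>\<^sub>M A \<Otimes>\<^sub>M A) (s, a1, a2)
   }"

text \<open>The label \<open>y\<close> is \<open>True\<close> iff \<open>a1\<close> is preferred to \<open>a2\<close>.\<close>

definition labelled_pairs ::
    "'s measure \<Rightarrow> 'a measure \<Rightarrow> ('s \<Rightarrow> 'a measure) \<Rightarrow> ('s \<Rightarrow> 'a \<Rightarrow> real) \<Rightarrow>
     ('s \<times> 'a \<times> 'a \<times> bool) measure" where
  "labelled_pairs P A \<pi> Rtrue = do {
     (s, a1, a2) \<leftarrow> action_pairs P A \<pi>;
     y \<leftarrow> measure_pmf (bernoulli_pmf (logistic (Rtrue s a1 - Rtrue s a2)));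
     return (P \<Otimes>\<^sub>M A \<Otimes>\<^sub>M A \<Otimes>\<^sub>M count_space UNIV) (s, a1, a2, y)
   }"

definition winner :: "'a \<Rightarrow> 'a \<Rightarrow> bool \<Rightarrow> 'a" where
  "winner a1 a2 y = (if y then a1 else a2)"

definition loser :: "'a \<Rightarrow> 'a \<Rightarrow> bool \<Rightarrow> 'a" where
  "loser a1 a2 y = (if y then a2 else a1)"

text \<open>
  The integrand \<open>- ln (logistic z)\<close> is positive, so \<open>ennreal\<close> truncates nothing and the
  expectation always exists in \<open>[0, \<infinity>]\<close>. A Bochner integral would return \<open>0\<close> instead of
  \<open>\<infinity>\<close> for a reward whose loss diverges. For \<open>R = Rtrue\<close> the loss is an average of binary
  entropies, hence at most \<open>ln 2\<close>; subtracting it in \<open>ereal\<close> is therefore unproblematic.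
\<close>

definition bt_loss ::
    "'s measure \<Rightarrow> 'a measure \<Rightarrow> ('s \<Rightarrow> 'a measure) \<Rightarrow> ('s \<Rightarrow> 'a \<Rightarrow> real) \<Rightarrow>
     ('s \<Rightarrow> 'a \<Rightarrow> real) \<Rightarrow> ereal" where
  "bt_loss P A \<pi> Rtrue R = enn2ereal
     (\<integral>\<^sup>+ (s, a1, a2, y).
        ennreal (- ln (logistic (R s (winner a1 a2 y) - R s (loser a1 a2 y))))
      \<partial>labelled_pairs P A \<pi> Rtrue)"

text \<open>
  The \<open>\<sigma>\<close>-algebra on actions is arbitrary, so the norm need not be jointly measurable in
  \<open>(a1, a2)\<close>. It is whenever \<open>A\<close> is Borel on a separable space, and then this is a measurable
  event for measurable \<open>R\<close>. A non-measurable set has \<open>measure\<close> \<open>0\<close>.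
\<close>

definition sharpness_set ::
    "'s measure \<Rightarrow> ('a::real_normed_vector) measure \<Rightarrow> ('s \<Rightarrow> 'a \<Rightarrow> real) \<Rightarrow> real \<Rightarrow> real \<Rightarrow>
     ('s \<times> 'a \<times> 'a) set" where
  "sharpness_set P A R K \<delta> =
     {(s, a1, a2) \<in> space (P \<Otimes>\<^sub>M A \<Otimes>\<^sub>M A). norm (a1 - a2) \<le> \<delta> \<and> \<bar>R s a1 - R s a2\<bar> > K}"

end

theory Submission
  imports Defs
begin

text \<open>
  Integrating out the label turns the excess loss into the expectation of the relative entropy
  of two Bernoulli distributions with parameters \<open>\<sigma>(w)\<close> and \<open>\<sigma>(z)\<close>, where \<open>w\<close> and \<open>z\<close> are the
  true and the proxy reward differences of the two actions. Pinsker's inequality bounds this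
  below by \<open>2 (\<sigma>(z) - \<sigma>(w))\<^sup>2\<close>. On the sharpness set \<open>\<bar>w\<bar> \<le> L \<delta> < K < \<bar>z\<bar>\<close>, so monotonicity and
  symmetry of \<open>\<sigma>\<close> give \<open>\<bar>\<sigma>(z) - \<sigma>(w)\<bar> \<ge> \<sigma>(K) - \<sigma>(L \<delta>)\<close>.
\<close>

section \<open>The logistic function and Bernoulli cross-entropy\<close>

lemma logistic_pos: "0 < logistic x"
  by (simp add: logistic_def add_pos_pos)

lemma logistic_less_one: "logistic x < 1"
  by (simp add: logistic_def add_pos_pos field_simps)

lemma logistic_minus: "logistic (- x) = 1 - logistic x"
proof -
  have "1 + exp x \<noteq> 0" "1 + exp (- x) \<noteq> 0"
    by (metis add_pos_pos exp_gt_zero less_irrefl zero_less_one)+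
  moreover have "exp x * exp (- x) = 1"
    by (simp flip: exp_add)
  ultimately show ?thesis
    by (simp add: logistic_def field_simps)
qed

lemma logistic_le_iff: "logistic x \<le> logistic y \<longleftrightarrow> x \<le> y"
  by (simp add: logistic_def divide_le_cancel frac_le_eq add_pos_pos field_simps)

lemma DERIV_logistic:
  "(logistic has_real_derivative logistic x * (1 - logistic x)) (at x)"
proof -
  have "1 + exp (- x) \<noteq> 0"
    by (metis add_pos_pos exp_gt_zero less_irrefl zero_less_one)
  then show ?thesis
    unfolding logistic_def [abs_def]
    by (auto intro!: derivative_eq_intros simp: field_simps power2_eq_square)
qed

lemma borel_measurable_logistic [measurable]: "logistic \<in> borel_measurable borel"
  unfolding logistic_def [abs_def] by measurable

lemma neg_ln_logistic_nonneg: "0 \<le> - ln (logistic x)"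
  using logistic_pos [of x] logistic_less_one [of x] by simp

text \<open>Cross-entropy of Bernoulli distributions: the expected loss at reward difference
  \<open>z\<close> when the first action wins with probability \<open>p\<close>. Keeping
  \<open>p\<close> separate from \<open>z\<close> allows differentiation in \<open>z\<close>
  alone.\<close>

definition logistic_loss :: "real \<Rightarrow> real \<Rightarrow> real" where
  "logistic_loss p z = p * (- ln (logistic z)) + (1 - p) * (- ln (logistic (- z)))"

lemma DERIV_logistic_loss:
  "(logistic_loss p has_real_derivative logistic z - p) (at z)"
proof -
  have *: "((\<lambda>z. logistic (- z)) has_real_derivative - (logistic z * (1 - logistic z))) (at z)"
    unfolding logistic_minus
    by (auto intro!: derivative_eq_intros DERIV_logistic)
  show ?thesis
    unfolding logistic_loss_def [abs_def]
    by (rule derivative_eq_intros DERIV_logistic * logistic_pos refl)+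
       (use logistic_pos [of z] logistic_less_one [of z] in \<open>simp add: logistic_minus field_simps\<close>)
qed

text \<open>Pinsker's inequality for Bernoulli distributions. The loss minus the quadratic term has
  a derivative in \<open>z\<close> with the sign of \<open>z - w\<close>, since the remaining factor
  is a square; hence it is minimal at \<open>z = w\<close>.\<close>

lemma logistic_loss_pinsker:
  "logistic_loss (logistic w) w + 2 * (logistic z - logistic w)\<^sup>2 \<le> logistic_loss (logistic w) z"
proof -
  define h where "h x = logistic_loss (logistic w) x - 2 * (logistic x - logistic w)\<^sup>2" for x
  have h: "(h has_real_derivative (logistic x - logistic w) * (1 - 2 * logistic x)\<^sup>2) (at x)" for x
    unfolding h_def [abs_def]
    by (rule derivative_eq_intros DERIV_logistic_loss DERIV_logistic refl)+
       (simp add: power2_eq_square algebra_simps)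
  have "h w \<le> h z"
  proof (cases "w \<le> z")
    case True
    then show ?thesis
      by (rule DERIV_nonneg_imp_nondecreasing)
         (meson h logistic_le_iff diff_ge_0_iff_ge mult_nonneg_nonneg zero_le_power2)
  next
    case False
    then have "z \<le> w" by simp
    then show ?thesis
      by (rule DERIV_nonpos_imp_nonincreasing)
         (meson h logistic_le_iff diff_le_0_iff_le mult_nonpos_nonneg zero_le_power2)
  qed
  then show ?thesis
    by (simp add: h_def)
qed

text \<open>Reward difference 0 gives both labels probability 1/2 and so costs \<open>ln 2\<close>
  whatever \<open>w\<close> is; by Pinsker the true difference costs no more.\<close>

lemma logistic_loss_le_ln2: "logistic_loss (logistic w) w \<le> ln 2"
proof -
  have "logistic_loss (logistic w) 0 = ln 2"
    by (simp add: logistic_loss_def logistic_def ln_div algebra_simps)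
  with logistic_loss_pinsker [of w 0] show ?thesis
    by (smt (verit) zero_le_power2)
qed

lemma logistic_loss_nonneg: "0 \<le> p \<Longrightarrow> p \<le> 1 \<Longrightarrow> 0 \<le> logistic_loss p z"
  unfolding logistic_loss_def
  by (intro add_nonneg_nonneg mult_nonneg_nonneg neg_ln_logistic_nonneg) auto

text \<open>By symmetry of \<sigma>, \<open>logistic w\<close> lies between
  \<open>1 - logistic b\<close> and \<open>logistic b\<close>, while \<open>logistic z\<close> lies
  above \<open>logistic K\<close> or below \<open>1 - logistic K\<close>. Both cases leave the same
  gap.\<close>

lemma logistic_gap:
  assumes "\<bar>w\<bar> \<le> b" "b < K" "K < \<bar>z\<bar>"
  shows "(logistic K - logistic b)\<^sup>2 \<le> (logistic z - logistic w)\<^sup>2"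
proof -
  have 1: "logistic b \<le> logistic K" "logistic w \<le> logistic b" "1 - logistic b \<le> logistic w"
    using assms by (simp_all add: logistic_le_iff flip: logistic_minus)
  have 2: "logistic K \<le> logistic z \<or> logistic z \<le> 1 - logistic K"
    using assms unfolding logistic_minus [symmetric] logistic_le_iff by linarith
  have "\<bar>logistic K - logistic b\<bar> \<le> \<bar>logistic z - logistic w\<bar>"
    using 1 2 by linarith
  then show ?thesis
    by (simp add: abs_le_square_iff)
qed

section \<open>Measurability of the sampling process and integration over the label\<close>

lemma measurable_bernoulli_pmf:
  assumes [measurable]: "p \<in> borel_measurable M"
    and p: "\<And>x. x \<in> space M \<Longrightarrow> 0 \<le> p x \<and> p x \<le> 1"
  shows "(\<lambda>x. measure_pmf (bernoulli_pmf (p x))) \<in> M \<rightarrow>\<^sub>M prob_algebra (count_space UNIV)"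
proof (rule measurable_prob_algebraI)
  show "(\<lambda>x. measure_pmf (bernoulli_pmf (p x))) \<in> M \<rightarrow>\<^sub>M subprob_algebra (count_space UNIV)"
  proof (rule measurable_subprob_algebra)
    fix B :: "bool set"
    \<comment> \<open>A set of labels is finite, so its probability is a finite sum of terms
      measurable in \<open>x\<close>.\<close>
    have "(\<lambda>x. ennreal (\<Sum>b\<in>B. if b then p x else 1 - p x)) \<in> borel_measurable M"
      by measurable
    also have "?this \<longleftrightarrow> (\<lambda>x. emeasure (measure_pmf (bernoulli_pmf (p x))) B) \<in> borel_measurable M"
      using p by (intro measurable_cong) (auto simp: emeasure_measure_pmf_finite intro!: sum.cong arg_cong [where f = ennreal])
    finally show "(\<lambda>x. emeasure (measure_pmf (bernoulli_pmf (p x))) B) \<in> borel_measurable M" .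
  qed (simp_all add: measure_pmf.subprob_space_axioms)
qed (simp add: measure_pmf.prob_space_axioms)

lemma action_pairs_in_space_prob_algebra:
  assumes "prob_space P" and [measurable]: "\<pi> \<in> P \<rightarrow>\<^sub>M prob_algebra A"
  shows "action_pairs P A \<pi> \<in> space (prob_algebra (P \<Otimes>\<^sub>M A \<Otimes>\<^sub>M A))"
proof -
  have P: "P \<in> space (prob_algebra P)"
    using assms(1) by (simp add: space_prob_algebra)
  have K: "(\<lambda>s. \<pi> s \<bind> (\<lambda>a1. \<pi> s \<bind> (\<lambda>a2. return (P \<Otimes>\<^sub>M A \<Otimes>\<^sub>M A) (s, a1, a2))))
      \<in> P \<rightarrow>\<^sub>M prob_algebra (P \<Otimes>\<^sub>M A \<Otimes>\<^sub>M A)"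
    by measurable
  show ?thesis
    unfolding action_pairs_def space_prob_algebra
    using prob_space_bind' [OF P K] sets_bind' [OF P K] by simp
qed

lemma bt_loss_eq:
  assumes "prob_space P" and "\<pi> \<in> P \<rightarrow>\<^sub>M prob_algebra A"
    and [measurable]: "case_prod Rtrue \<in> borel_measurable (P \<Otimes>\<^sub>M A)"
    and [measurable]: "case_prod R \<in> borel_measurable (P \<Otimes>\<^sub>M A)"
  shows "bt_loss P A \<pi> Rtrue R = enn2ereal
    (\<integral>\<^sup>+ (s, a1, a2). ennreal (logistic_loss (logistic (Rtrue s a1 - Rtrue s a2)) (R s a1 - R s a2))
      \<partial>action_pairs P A \<pi>)"
proof -
  define M where "M = P \<Otimes>\<^sub>M A \<Otimes>\<^sub>M A"
  define N where "N = P \<Otimes>\<^sub>M A \<Otimes>\<^sub>M A \<Otimes>\<^sub>M count_space (UNIV :: bool set)"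
  define p where "p = (\<lambda>(s, a1, a2). logistic (Rtrue s a1 - Rtrue s a2))"
  define l where "l = (\<lambda>(s, a1, a2, y). ennreal (- ln (logistic (R s (winner a1 a2 y) - R s (loser a1 a2 y)))))"
  \<comment> \<open>The kernel that appends a random label to a triple; binding
    \<open>action_pairs\<close> with it gives \<open>labelled_pairs\<close>.\<close>
  define \<kappa> where "\<kappa> = (\<lambda>(s, a1, a2). measure_pmf (bernoulli_pmf (p (s, a1, a2))) \<bind>
    (\<lambda>y. return N (s, a1, a2, y)))"
  have D: "sets (action_pairs P A \<pi>) = sets M"
    using action_pairs_in_space_prob_algebra [OF assms(1,2)] by (simp add: space_prob_algebra M_def)
  have p01: "0 \<le> p x" "p x \<le> 1" for x
    by (auto simp: p_def less_imp_le logistic_pos logistic_less_one split: prod.split)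
  have [measurable]: "p \<in> borel_measurable M"
    unfolding p_def M_def by measurable
  have [measurable]: "(\<lambda>x. measure_pmf (bernoulli_pmf (p x))) \<in> M \<rightarrow>\<^sub>M prob_algebra (count_space UNIV)"
    using p01 by (intro measurable_bernoulli_pmf) auto
  have return: "(\<lambda>y. return N (s, a1, a2, y)) \<in> count_space UNIV \<rightarrow>\<^sub>M subprob_algebra N"
    if "(s, a1, a2) \<in> space M" for s a1 a2
    using that by (auto simp: N_def M_def space_pair_measure space_subprob_algebra
        intro!: prob_space_imp_subprob_space prob_space_return)
  \<comment> \<open>Reassociation: the bind rule works with pairs of triple and label, whereas
    \<open>N\<close> nests to the right.\<close>
  have "(\<lambda>(x, y). (fst x, fst (snd x), snd (snd x), y)) \<in> M \<Otimes>\<^sub>M count_space UNIV \<rightarrow>\<^sub>M N"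
    unfolding M_def N_def by measurable
  then have "(\<lambda>(x, y). return N (fst x, fst (snd x), snd (snd x), y))
      \<in> M \<Otimes>\<^sub>M count_space UNIV \<rightarrow>\<^sub>M prob_algebra N"
    using measurable_compose [OF _ measurable_return_prob_space] by (auto simp: split_beta')
  then have "\<kappa> \<in> M \<rightarrow>\<^sub>M prob_algebra N"
    unfolding \<kappa>_def split_beta' prod.collapse
    by (intro measurable_bind_prob_space2 [where N = "count_space UNIV"]) (simp_all add: split_beta')
  then have \<kappa>: "\<kappa> \<in> M \<rightarrow>\<^sub>M subprob_algebra N"
    by (rule measurable_prob_algebraD)
  have l: "l \<in> borel_measurable N"
    unfolding l_def winner_def loser_def N_def by measurable
  have "(\<integral>\<^sup>+ x. l x \<partial>labelled_pairs P A \<pi> Rtrue) = (\<integral>\<^sup>+ x. \<integral>\<^sup>+ y. l y \<partial>\<kappa> x \<partial>action_pairs P A \<pi>)"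
    unfolding labelled_pairs_def
    using \<kappa> l by (subst nn_integral_bind [symmetric, where B = N])
      (simp_all add: D \<kappa>_def p_def N_def split_beta' cong: measurable_cong_sets)
  also have "\<dots> = (\<integral>\<^sup>+ (s, a1, a2). ennreal (logistic_loss (logistic (Rtrue s a1 - Rtrue s a2)) (R s a1 - R s a2))
      \<partial>action_pairs P A \<pi>)"
  proof (rule nn_integral_cong)
    fix x assume "x \<in> space (action_pairs P A \<pi>)"
    then have x: "x \<in> space M"
      using sets_eq_imp_space_eq [OF D] by simp
    obtain s a1 a2 where [simp]: "x = (s, a1, a2)"
      by (cases x)
    have N: "(s, a1, a2, y) \<in> space N" for y
      using x by (simp add: N_def M_def space_pair_measure)
    have "(\<integral>\<^sup>+ y. l y \<partial>\<kappa> x) = (\<integral>\<^sup>+ y. l (s, a1, a2, y) \<partial>bernoulli_pmf (p x))"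
      using x l return by (simp add: \<kappa>_def nn_integral_bind [where B = N] nn_integral_return N)
    also have "\<dots> = l (s, a1, a2, True) * p x + l (s, a1, a2, False) * (1 - p x)"
      using p01 by simp
    \<comment> \<open>The label \<open>False\<close> swaps winner and loser and so negates the
      reward difference. Both summands are nonnegative, so \<open>ennreal\<close> is additive on
      them.\<close>
    also have "\<dots> = ennreal (logistic_loss (p x) (R s a1 - R s a2))"
      unfolding logistic_loss_def using p01 [of x] neg_ln_logistic_nonneg
      by (subst ennreal_plus) (simp_all add: l_def winner_def loser_def mult.commute
          mult_nonneg_nonpos flip: ennreal_mult')
    finally show "(\<integral>\<^sup>+ y. l y \<partial>\<kappa> x) = (case x of (s, a1, a2) \<Rightarrow>
        ennreal (logistic_loss (logistic (Rtrue s a1 - Rtrue s a2)) (R s a1 - R s a2)))"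
      by (simp add: p_def)
  qed
  finally show ?thesis
    by (simp add: bt_loss_def l_def)
qed

section \<open>The lower bound on the excess loss\<close>

theorem proposition3p4:
  fixes P :: "'s measure"
    and A :: "('a::real_normed_vector) measure"
    and \<pi> :: "'s \<Rightarrow> 'a measure"
    and Rtrue Rproxy :: "'s \<Rightarrow> 'a \<Rightarrow> real"
    and L \<delta> K :: real
  assumes "prob_space P"
    and "\<pi> \<in> P \<rightarrow>\<^sub>M prob_algebra A"
    and "case_prod Rtrue \<in> borel_measurable (P \<Otimes>\<^sub>M A)"
    and "case_prod Rproxy \<in> borel_measurable (P \<Otimes>\<^sub>M A)"
    and "\<And>s. s \<in> space P \<Longrightarrow> L-lipschitz_on (space A) (Rtrue s)"
    and "\<delta> > 0"
    and "K > L * \<delta>"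
  shows "bt_loss P A \<pi> Rtrue Rproxy - bt_loss P A \<pi> Rtrue Rtrue \<ge>
     ereal (2 * (logistic K - logistic (L * \<delta>))\<^sup>2 *
       measure (action_pairs P A \<pi>) (sharpness_set P A Rproxy K \<delta>))"
proof -
  define D where "D = action_pairs P A \<pi>"
  define S where "S = sharpness_set P A Rproxy K \<delta>"
  \<comment> \<open>\<^term>\<open>S\<close> may fail to be measurable, and then its \<^const>\<open>measure\<close> is \<open>0\<close>.\<close>
  define T where "T = (if S \<in> sets D then S else {})"
  define c where "c = 2 * (logistic K - logistic (L * \<delta>))\<^sup>2"
  define loss where "loss R = (\<lambda>(s, a1, a2).
    logistic_loss (logistic (Rtrue s a1 - Rtrue s a2)) (R s a1 - R s a2))" for R :: "'s \<Rightarrow> 'a \<Rightarrow> real"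
  note [measurable] = assms(3,4)
  have "prob_space D" and sets_D: "sets D = sets (P \<Otimes>\<^sub>M A \<Otimes>\<^sub>M A)"
    using action_pairs_in_space_prob_algebra [OF assms(1,2)]
    by (simp_all add: D_def space_prob_algebra)
  interpret D: prob_space D by fact
  have [measurable]: "T \<in> sets D"
    by (simp add: T_def)
  have [measurable]: "loss Rtrue \<in> borel_measurable D"
    unfolding loss_def logistic_loss_def measurable_cong_sets [OF sets_D refl] by measurable
  have loss_nonneg: "0 \<le> loss R x" for R x
    by (auto simp: loss_def less_imp_le logistic_pos logistic_less_one logistic_loss_nonneg split: prod.split)
  have c: "0 \<le> c"
    by (simp add: c_def)
  have bt: "bt_loss P A \<pi> Rtrue R = enn2ereal (\<integral>\<^sup>+ x. ennreal (loss R x) \<partial>D)"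
    if "case_prod R \<in> borel_measurable (P \<Otimes>\<^sub>M A)" for R
    by (subst bt_loss_eq [OF assms(1-3) that]) (simp add: D_def loss_def split_beta')
  \<comment> \<open>Off \<open>T\<close> the square in Pinsker's inequality is dropped; on
    \<open>T\<close> it is bounded below by the logistic gap.\<close>
  have pointwise: "loss Rtrue x + c * indicator T x \<le> loss Rproxy x" for x
  proof (cases "x \<in> T")
    case False
    obtain s a1 a2 where x: "x = (s, a1, a2)"
      by (cases x)
    from False show ?thesis
      using logistic_loss_pinsker [of "Rtrue s a1 - Rtrue s a2" "Rproxy s a1 - Rproxy s a2"]
      by (simp add: loss_def x) (smt (verit) zero_le_power2)
  next
    case True
    obtain s a1 a2 where x: "x = (s, a1, a2)"
      by (cases x)
    from True have *: "s \<in> space P" "a1 \<in> space A" "a2 \<in> space A"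
        "norm (a1 - a2) \<le> \<delta>" "K < \<bar>Rproxy s a1 - Rproxy s a2\<bar>"
      by (auto simp: T_def S_def sharpness_set_def x space_pair_measure split: if_splits)
    note lip = assms(5) [OF *(1)]
    have "\<bar>Rtrue s a1 - Rtrue s a2\<bar> \<le> L * norm (a1 - a2)"
      using lipschitz_onD [OF lip *(2,3)] by (simp add: dist_norm)
    \<comment> \<open>\<open>L\<close> is nonnegative because \<open>lipschitz_on\<close> includes
      this.\<close>
    also have "\<dots> \<le> L * \<delta>"
      using *(4) lipschitz_on_nonneg [OF lip] by (rule mult_left_mono)
    finally have "c \<le> 2 * (logistic (Rproxy s a1 - Rproxy s a2) - logistic (Rtrue s a1 - Rtrue s a2))\<^sup>2"
      unfolding c_def using logistic_gap [OF _ assms(7) *(5)] by simp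
    with True show ?thesis
      using logistic_loss_pinsker [of "Rtrue s a1 - Rtrue s a2" "Rproxy s a1 - Rproxy s a2"]
      by (simp add: loss_def x)
  qed
  \<comment> \<open>The pointwise bound is integrated in additive form, which stays meaningful when
    the proxy loss is infinite.\<close>
  have "(\<integral>\<^sup>+ x. ennreal (loss Rtrue x) \<partial>D) + ennreal (c * measure D T)
      = (\<integral>\<^sup>+ x. ennreal (loss Rtrue x) + ennreal c * indicator T x \<partial>D)"
    using c by (simp add: nn_integral_add nn_integral_cmult D.emeasure_eq_measure ennreal_mult')
  also have "\<dots> = (\<integral>\<^sup>+ x. ennreal (loss Rtrue x + c * indicator T x) \<partial>D)"
    using c loss_nonneg by (intro nn_integral_cong) (auto simp: indicator_def)
  also have "\<dots> \<le> (\<integral>\<^sup>+ x. ennreal (loss Rproxy x) \<partial>D)"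
    by (intro nn_integral_mono ennreal_leI pointwise)
  finally have ineq: "enn2ereal (\<integral>\<^sup>+ x. ennreal (loss Rtrue x) \<partial>D) + ereal (c * measure D T)
      \<le> enn2ereal (\<integral>\<^sup>+ x. ennreal (loss Rproxy x) \<partial>D)"
    using c by (simp add: less_eq_ennreal.rep_eq plus_ennreal.rep_eq enn2ereal_ennreal)
  \<comment> \<open>The true loss is finite, so it can be moved across the inequality in
    \<open>ereal\<close>.\<close>
  have "(\<integral>\<^sup>+ x. ennreal (loss Rtrue x) \<partial>D) \<le> (\<integral>\<^sup>+ x. ennreal (ln 2) \<partial>D)"
    by (intro nn_integral_mono ennreal_leI)
       (auto simp: loss_def logistic_loss_le_ln2 split: prod.split)
  then have "(\<integral>\<^sup>+ x. ennreal (loss Rtrue x) \<partial>D) < \<top>"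
    by (simp add: D.emeasure_space_1 le_less_trans)
  then have "\<bar>enn2ereal (\<integral>\<^sup>+ x. ennreal (loss Rtrue x) \<partial>D)\<bar> \<noteq> \<infinity>"
    by (cases "\<integral>\<^sup>+ x. ennreal (loss Rtrue x) \<partial>D" rule: ennreal_cases) (auto simp: enn2ereal_ennreal)
  moreover have "measure D T = measure D S"
    by (simp add: T_def measure_notin_sets)
  ultimately show ?thesis
    using ineq by (simp add: bt assms(3,4) D_def [symmetric] S_def [symmetric] c_def [symmetric]
        ereal_le_minus add.commute)
qed

end
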